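(* For all positive integers $n,k$ and all $0\le i\le n$, $$\frac{|\mathcal{IS}_{n-i}|^k}{|\mathcal{IS}_n|^k}\cdot\left([n]_i\right)^{k-1}\;\ge\; P_{k,n}^{(i)}\;\ge\;\frac{|\mathcal{IS}_{n-i}|^{k-1}}{|\mathcal{IS}_n|^k}\cdot\left([n]_i\right)^{k-1}.$$
   Context: For $m\ge0$, $\mathcal{IS}_m$ is the symmetric inverse semigroup of all partial injective maps from $\{1,\dots,m\}$ to itself, under composition of partial maps, with products read left to right; $\mathcal{IS}_0=\{0\}$ has one element. The rank of $\alpha\in\mathcal{IS}_n$ is $|\operatorname{dom}(\alpha)|$. Let $x_1,\dots,x_k$ be chosen independently and uniformly at random from $\mathcal{IS}_n$. For $0\le i\le n$, $P_{k,n}^{(i)}$ is the probability that the product $x_1x_2\cdots x_k$ equals a fixed element of $\mathcal{IS}_n$ of rank $i$; this probability does not depend on the choice of the element of rank $i$. $[x]_i=x(x-1)\cdots(x-i+1)$ is the decreasing factorial, $[x]_0=1$. *)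

theory Defs
  imports "HOL-Probability.Probability"
begin

definition sym_inv :: "nat \<Rightarrow> (nat \<rightharpoonup> nat) set" where
  "sym_inv m = {f. dom f \<subseteq> {1..m} \<and> ran f \<subseteq> {1..m} \<and> inj_on f (dom f)}"

definition pmap_rank :: "(nat \<rightharpoonup> nat) \<Rightarrow> nat" where
  "pmap_rank f = card (dom f)"

(* Products are read left to right, whereas g \<circ>\<^sub>m f applies f first. *)
definition pmap_mult :: "(nat \<rightharpoonup> nat) \<Rightarrow> (nat \<rightharpoonup> nat) \<Rightarrow> (nat \<rightharpoonup> nat)" where
  "pmap_mult f g = g \<circ>\<^sub>m f"

(* The product x_1 x_2 ... x_k; the empty product is the identity map of {1..n}. *)
definition pmap_prod :: "nat \<Rightarrow> (nat \<rightharpoonup> nat) list \<Rightarrow> (nat \<rightharpoonup> nat)" where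
  "pmap_prod n xs = foldl pmap_mult (Some |` {1..n}) xs"

(* The probability that x_1 x_2 ... x_k = \<alpha>, where x_1, ..., x_k are independent and
   uniformly distributed on sym_inv n. *)
definition prod_prob :: "nat \<Rightarrow> nat \<Rightarrow> (nat \<rightharpoonup> nat) \<Rightarrow> real" where
  "prod_prob k n \<alpha> =
     measure_pmf.prob (replicate_pmf k (pmf_of_set (sym_inv n))) {xs. pmap_prod n xs = \<alpha>}"

definition falling_fact :: "real \<Rightarrow> nat \<Rightarrow> real" where
  "falling_fact x i = (\<Prod>j<i. x - real j)"

(* pmf_of_set is the uniform distribution only on finite nonempty sets. *)
lemma finite_sym_inv: "finite (sym_inv m)"
proof (rule finite_subset)
  show "sym_inv m \<subseteq> (\<Union>D\<in>Pow {1..m}. {f. dom f = D \<and> ran f \<subseteq> {1..m}})"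
    by (auto simp: sym_inv_def)
  show "finite (\<Union>D\<in>Pow {1..m}. {f :: nat \<rightharpoonup> nat. dom f = D \<and> ran f \<subseteq> {1..m}})"
    by (intro finite_UN_I finite_set_of_finite_maps) (auto intro: finite_subset)
qed

lemma sym_inv_nonempty: "sym_inv m \<noteq> {}"
proof -
  have "Map.empty \<in> sym_inv m"
    by (simp add: sym_inv_def)
  then show ?thesis by blast
qed

end

theory Submission
  imports Defs
begin

text \<open>
  The products that equal \<open>\<alpha>\<close> are awkward to count, but those that \<^emph>\<open>extend\<close> \<open>\<alpha>\<close> are not.
  Let \<open>D\<close> be the domain of \<open>\<alpha>\<close>, a set of size \<open>i\<close>. If \<open>x\<^sub>1 \<dots> x\<^sub>k\<close> extends \<open>\<alpha>\<close>, then each partial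
  product \<open>x\<^sub>1 \<dots> x\<^sub>j\<close> restricts to an injection \<open>\<beta>\<^sub>j\<close> of \<open>D\<close> into \<open>{1..n}\<close>, with \<open>\<beta>\<^sub>0\<close> the inclusion
  and \<open>\<beta>\<^sub>k = \<alpha>\<close>. The \<open>k - 1\<close> injections in between are arbitrary, so that there are \<open>([n]\<^sub>i)\<^sup>k\<^sup>-\<^sup>1\<close>
  choices for them; once they are chosen, the only condition on \<open>x\<^sub>j\<close> is that it extends the
  partial injection \<open>\<beta>\<^sub>j\<^sub>-\<^sub>1\<^sup>-\<^sup>1\<beta>\<^sub>j\<close> of rank \<open>i\<close>. Such an extension is a partial injection between the
  complements of its domain and of its range, and there are \<open>|IS\<^sub>n\<^sub>-\<^sub>i|\<close> of those. Hence exactly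
  \<open>([n]\<^sub>i)\<^sup>k\<^sup>-\<^sup>1 |IS\<^sub>n\<^sub>-\<^sub>i|\<^sup>k\<close> tuples have a product that extends \<open>\<alpha>\<close> (\<open>card_extending_tuples\<close>).

  This number is the upper bound. For the lower bound, keep the first \<open>k - 1\<close> factors as free as
  before and take \<open>\<beta>\<^sub>k\<^sub>-\<^sub>1\<^sup>-\<^sup>1\<alpha>\<close> itself as the last factor: it cuts the product down to \<open>\<alpha>\<close>, at the
  price of one factor \<open>|IS\<^sub>n\<^sub>-\<^sub>i|\<close> (\<open>card_exact_tuples_ge\<close>).
\<close>

section \<open>Partial injections\<close>

lemma map_le_iff_Some: "f \<subseteq>\<^sub>m g \<longleftrightarrow> (\<forall>a b. f a = Some b \<longrightarrow> g a = Some b)"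
  by (auto simp: map_le_def dom_def)

definition partial_injections :: "'a set \<Rightarrow> 'b set \<Rightarrow> ('a \<rightharpoonup> 'b) set" where
  "partial_injections A B = {f. dom f \<subseteq> A \<and> ran f \<subseteq> B \<and> inj_on f (dom f)}"

lemma sym_inv_eq_partial_injections: "sym_inv m = partial_injections {1..m} {1..m}"
  by (simp add: sym_inv_def partial_injections_def)

lemma partial_injections_iff:
  "f \<in> partial_injections A B \<longleftrightarrow>
     (\<forall>a b. f a = Some b \<longrightarrow> a \<in> A \<and> b \<in> B) \<and>
     (\<forall>a a' b. f a = Some b \<longrightarrow> f a' = Some b \<longrightarrow> a = a')"
  by (fastforce simp: partial_injections_def inj_on_def dom_def ran_def)

lemma partial_injections_injD:
  "f \<in> partial_injections A B \<Longrightarrow> f a = Some b \<Longrightarrow> f a' = Some b \<Longrightarrow> a = a'"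
  by (auto simp: partial_injections_iff)

lemma finite_partial_injections:
  assumes "finite A" "finite B"
  shows "finite (partial_injections A B)"
proof (rule finite_subset)
  show "partial_injections A B \<subseteq> (\<Union>D\<in>Pow A. {f. dom f = D \<and> ran f \<subseteq> B})"
    by (auto simp: partial_injections_def)
  show "finite (\<Union>D\<in>Pow A. {f :: 'a \<rightharpoonup> 'b. dom f = D \<and> ran f \<subseteq> B})"
    using assms by (intro finite_UN_I finite_set_of_finite_maps) (auto intro: finite_subset)
qed

lemma card_partial_injections_le:
  fixes A :: "'a set" and B :: "'b set" and A' :: "'c set" and B' :: "'d set"
  assumes fin: "finite A'" "finite B'" and "bij_betw g A' A" and "bij_betw h B B'"
  shows "card (partial_injections A B) \<le> card (partial_injections A' B')"
proof -
  define relabel where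
    "relabel f = (\<lambda>a. if a \<in> A' then map_option h (f (g a)) else None)" for f :: "'a \<rightharpoonup> 'b"
  have g: "inj_on g A'" "g ` A' = A" and h: "inj_on h B" "h ` B = B'"
    using assms by (auto simp: bij_betw_def)
  have "inj_on relabel (partial_injections A B)"
  proof (rule inj_onI, rule ext)
    fix f f' x
    assume f: "f \<in> partial_injections A B" and f': "f' \<in> partial_injections A B"
      and eq: "relabel f = relabel f'"
    show "f x = f' x"
    proof (cases "x \<in> A")
      case True
      then obtain a where a: "a \<in> A'" "x = g a"
        using g(2) by auto
      with fun_cong[OF eq, of a] have "map_option h (f x) = map_option h (f' x)"
        by (simp add: relabel_def)
      then show ?thesis
        using f f' h(1) by (cases "f x"; cases "f' x") (auto simp: partial_injections_iff inj_on_def)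
    next
      case False
      with f f' show ?thesis
        by (cases "f x"; cases "f' x") (auto simp: partial_injections_iff)
    qed
  qed
  moreover have "relabel f \<in> partial_injections A' B'" if f: "f \<in> partial_injections A B" for f
    unfolding partial_injections_iff
  proof (intro conjI allI impI)
    fix a b assume "relabel f a = Some b"
    then obtain y where "a \<in> A'" "f (g a) = Some y" "b = h y"
      by (auto simp: relabel_def split: if_splits)
    with f h(2) show "a \<in> A'" "b \<in> B'"
      by (auto simp: partial_injections_iff)
  next
    fix a a' b assume "relabel f a = Some b" "relabel f a' = Some b"
    then obtain y y' where y: "a \<in> A'" "f (g a) = Some y" "b = h y"
        "a' \<in> A'" "f (g a') = Some y'" "b = h y'"
      by (auto simp: relabel_def split: if_splits)
    with f have "y \<in> B" "y' \<in> B"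
      by (auto simp: partial_injections_iff)
    with y h(1) have "y = y'"
      by (metis inj_onD)
    with y have "g a = g a'"
      using partial_injections_injD[OF f] by metis
    with y g(1) show "a = a'"
      by (metis inj_onD)
  qed
  ultimately show ?thesis
    using fin by (intro card_inj_on_le[of relabel] finite_partial_injections) auto
qed

lemma card_partial_injections_cong:
  assumes "finite A" "finite B" "finite A'" "finite B'" "card A = card A'" "card B = card B'"
  shows "card (partial_injections A B) = card (partial_injections A' B')"
proof -
  obtain g h where "bij_betw g A' A" "bij_betw h B B'"
    using assms by (metis finite_same_card_bij)
  then show ?thesis
    using assms by (intro antisym card_partial_injections_le[where g = g and h = h]
        card_partial_injections_le[where g = "inv_into A' g" and h = "inv_into B h"])
      (auto intro: bij_betw_inv_into)
qed

lemma card_ran_partial_injection: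
  assumes "f \<in> partial_injections A B"
  shows "card (ran f) = card (dom f)"
proof -
  have "Some ` ran f = f ` dom f"
    by (force simp: ran_def dom_def image_iff)
  moreover have "inj_on f (dom f)"
    using assms by (simp add: partial_injections_def)
  ultimately show ?thesis
    by (metis card_image inj_Some)
qed

text \<open>
  Removing the points of \<open>dom f\<close> turns an extension of \<open>f\<close> into a partial injection between the
  complements of \<open>dom f\<close> and \<open>ran f\<close>, and every such partial injection can be added to \<open>f\<close>.
\<close>

lemma card_extensions:
  assumes f: "f \<in> partial_injections A B"
  shows "card {x \<in> partial_injections A B. f \<subseteq>\<^sub>m x}
           = card (partial_injections (A - dom f) (B - ran f))"
proof (rule bij_betw_same_card[of "\<lambda>x. x |` (- dom f)"], rule bij_betw_byWitness[where f' = "\<lambda>y. y ++ f"])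
  show "\<forall>x\<in>{x \<in> partial_injections A B. f \<subseteq>\<^sub>m x}. x |` (- dom f) ++ f = x"
    by (auto simp: fun_eq_iff map_add_def restrict_map_def map_le_def dom_def split: option.splits)
  show "\<forall>y\<in>partial_injections (A - dom f) (B - ran f). (y ++ f) |` (- dom f) = y"
  proof (intro ballI ext)
    fix y x assume "y \<in> partial_injections (A - dom f) (B - ran f)"
    then show "((y ++ f) |` (- dom f)) x = y x"
      by (cases "y x") (auto simp: partial_injections_iff map_add_def restrict_map_def dom_def
          split: option.splits)
  qed
  show "(\<lambda>x. x |` (- dom f)) ` {x \<in> partial_injections A B. f \<subseteq>\<^sub>m x}
      \<subseteq> partial_injections (A - dom f) (B - ran f)"
  proof safe
    fix x assume x: "x \<in> partial_injections A B" and le: "f \<subseteq>\<^sub>m x"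
    have "b \<notin> ran f" if "x a = Some b" "a \<notin> dom f" for a b
    proof
      assume "b \<in> ran f"
      then obtain a' where "f a' = Some b"
        by (auto simp: ran_def)
      with le have "x a' = Some b" "a' \<in> dom f"
        by (auto simp: map_le_iff_Some)
      with that x show False
        by (metis partial_injections_injD)
    qed
    with x show "x |` (- dom f) \<in> partial_injections (A - dom f) (B - ran f)"
      by (auto simp: partial_injections_iff restrict_map_def split: if_splits)
  qed
  show "(\<lambda>y. y ++ f) ` partial_injections (A - dom f) (B - ran f)
      \<subseteq> {x \<in> partial_injections A B. f \<subseteq>\<^sub>m x}"
  proof safe
    fix y assume y: "y \<in> partial_injections (A - dom f) (B - ran f)"
    show "y ++ f \<in> partial_injections A B"
      unfolding partial_injections_iff
    proof (intro conjI allI impI)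
      fix a b assume "(y ++ f) a = Some b"
      then show "a \<in> A" "b \<in> B"
        using f y by (auto simp: partial_injections_iff)
    next
      fix a a' b assume "(y ++ f) a = Some b" "(y ++ f) a' = Some b"
      then show "a = a'"
        using f y by (auto simp: partial_injections_iff ran_def)
    qed
  qed (simp add: map_le_map_add)
qed

lemma card_extensions_sym_inv:
  assumes f: "f \<in> sym_inv n"
  shows "card {x \<in> sym_inv n. f \<subseteq>\<^sub>m x} = card (sym_inv (n - card (dom f)))"
proof -
  have f': "f \<in> partial_injections {1..n} {1..n}"
    using f by (simp add: sym_inv_eq_partial_injections)
  then have sub: "dom f \<subseteq> {1..n}" "ran f \<subseteq> {1..n}"
    by (auto simp: partial_injections_def)
  then have "finite (dom f)" "finite (ran f)"
    by (auto intro: finite_subset)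
  with sub have "card (partial_injections ({1..n} - dom f) ({1..n} - ran f))
      = card (partial_injections {1..n - card (dom f)} {1..n - card (dom f)})"
    by (intro card_partial_injections_cong)
      (simp_all add: card_Diff_subset card_ran_partial_injection[OF f'])
  then show ?thesis
    using card_extensions[OF f'] by (simp add: sym_inv_eq_partial_injections)
qed

lemma card_sym_inv_dom_eq:
  assumes D: "D \<subseteq> {1..n}"
  shows "real (card {\<beta> \<in> sym_inv n. dom \<beta> = D}) = falling_fact (real n) (card D)"
proof -
  have fin: "finite D"
    using D finite_subset by blast
  have "card D \<le> n"
    using card_mono[OF _ D] by simp
  let ?to_map = "\<lambda>h x. if x \<in> D then Some (h x) else None"
  have "bij_betw ?to_map {h \<in> D \<rightarrow>\<^sub>E {1..n}. inj_on h D} {\<beta> \<in> sym_inv n. dom \<beta> = D}"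
  proof (rule bij_betw_byWitness[where f' = "\<lambda>\<beta>. restrict (\<lambda>x. the (\<beta> x)) D"])
    show "\<forall>h\<in>{h \<in> D \<rightarrow>\<^sub>E {1..n}. inj_on h D}. restrict (\<lambda>x. the (?to_map h x)) D = h"
      by (auto simp: fun_eq_iff restrict_def PiE_def extensional_def)
    show "\<forall>\<beta>\<in>{\<beta> \<in> sym_inv n. dom \<beta> = D}. ?to_map (restrict (\<lambda>x. the (\<beta> x)) D) = \<beta>"
      by (auto simp: fun_eq_iff dom_def)
    show "?to_map ` {h \<in> D \<rightarrow>\<^sub>E {1..n}. inj_on h D} \<subseteq> {\<beta> \<in> sym_inv n. dom \<beta> = D}"
    proof (rule image_subsetI)
      fix h assume "h \<in> {h \<in> D \<rightarrow>\<^sub>E {1..n}. inj_on h D}"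
      then have h: "h \<in> D \<rightarrow>\<^sub>E {1..n}" "inj_on h D"
        by simp_all
      have val: "?to_map h x = Some y \<longleftrightarrow> x \<in> D \<and> h x = y" for x y
        by simp
      have "?to_map h \<in> partial_injections {1..n} {1..n}"
        unfolding partial_injections_iff val
      proof (intro conjI allI impI)
        fix x y assume xy: "x \<in> D \<and> h x = y"
        then show "x \<in> {1..n}"
          using D by blast
        show "y \<in> {1..n}"
          using PiE_mem[OF h(1), of x] xy by simp
      next
        fix x x' y assume "x \<in> D \<and> h x = y" "x' \<in> D \<and> h x' = y"
        then show "x = x'"
          using inj_onD[OF h(2), of x x'] by simp
      qed
      moreover have "dom (?to_map h) = D"
        by (auto simp: dom_def)
      ultimately show "?to_map h \<in> {\<beta> \<in> sym_inv n. dom \<beta> = D}"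
        by (simp add: sym_inv_eq_partial_injections)
    qed
    show "(\<lambda>\<beta>. restrict (\<lambda>x. the (\<beta> x)) D) ` {\<beta> \<in> sym_inv n. dom \<beta> = D}
        \<subseteq> {h \<in> D \<rightarrow>\<^sub>E {1..n}. inj_on h D}"
    proof (rule image_subsetI)
      fix \<beta> assume "\<beta> \<in> {\<beta> \<in> sym_inv n. dom \<beta> = D}"
      then have \<beta>: "\<beta> \<in> partial_injections {1..n} {1..n}" and "dom \<beta> = D"
        by (simp_all add: sym_inv_eq_partial_injections)
      then have val: "\<beta> x = Some (the (\<beta> x))" if "x \<in> D" for x
        using that by auto
      have "the (\<beta> x) \<in> {1..n}" if "x \<in> D" for x
        using \<beta> val[OF that] unfolding partial_injections_iff by blast
      moreover have "inj_on (\<lambda>x. the (\<beta> x)) D"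
      proof (rule inj_onI)
        fix x y assume "x \<in> D" "y \<in> D" "the (\<beta> x) = the (\<beta> y)"
        with val[of x] val[of y] show "x = y"
          by (intro partial_injections_injD[OF \<beta>, of x "the (\<beta> x)" y]) simp_all
      qed
      ultimately show "restrict (\<lambda>x. the (\<beta> x)) D \<in> {h \<in> D \<rightarrow>\<^sub>E {1..n}. inj_on h D}"
        by simp
    qed
  qed
  then have "card {\<beta> \<in> sym_inv n. dom \<beta> = D} = card {h \<in> D \<rightarrow>\<^sub>E {1..n}. inj_on h D}"
    by (simp add: bij_betw_same_card)
  also have "\<dots> = (\<Prod>j<card D. n - j)"
    using card_inj_on_subset_funcset[OF fin finite_atLeastAtMost[of 1 n] subset_refl]
    by (simp add: lessThan_atLeast0)
  finally show ?thesis
    using \<open>card D \<le> n\<close> by (simp add: falling_fact_def of_nat_diff)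
qed

section \<open>The semigroup of partial injections\<close>

lemma pmap_mult_Some_iff:
  "pmap_mult f g a = Some c \<longleftrightarrow> (\<exists>b. f a = Some b \<and> g b = Some c)"
  by (simp add: pmap_mult_def map_comp_Some_iff)

lemma pmap_mult_in_sym_inv:
  "f \<in> sym_inv n \<Longrightarrow> g \<in> sym_inv n \<Longrightarrow> pmap_mult f g \<in> sym_inv n"
  unfolding sym_inv_eq_partial_injections partial_injections_iff pmap_mult_Some_iff by metis

lemma pmap_prod_Nil: "pmap_prod n [] = Some |` {1..n}"
  by (simp add: pmap_prod_def)

lemma pmap_prod_snoc: "pmap_prod n (xs @ [x]) = pmap_mult (pmap_prod n xs) x"
  by (simp add: pmap_prod_def)

lemma pmap_prod_in_sym_inv: "set xs \<subseteq> sym_inv n \<Longrightarrow> pmap_prod n xs \<in> sym_inv n"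
proof (induction xs rule: rev_induct)
  case Nil
  show ?case
    by (auto simp: pmap_prod_Nil sym_inv_eq_partial_injections partial_injections_iff
        restrict_map_def split: if_splits)
next
  case (snoc x xs)
  then show ?case
    by (simp add: pmap_prod_snoc pmap_mult_in_sym_inv)
qed

lemma pmap_prod_singleton:
  assumes "x \<in> sym_inv n"
  shows "pmap_prod n [x] = x"
proof
  fix a
  have "dom x \<subseteq> {1..n}"
    using assms by (simp add: sym_inv_def)
  then show "pmap_prod n [x] a = x a"
    by (cases "x a") (auto simp: pmap_prod_def pmap_mult_def map_comp_def restrict_map_def)
qed

text \<open>
  The product \<open>\<beta>\<^sup>-\<^sup>1\<alpha>\<close> of partial maps, read left to right. For a non-injective \<open>\<beta>\<close> the preimage is
  picked arbitrarily.
\<close>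

definition left_quotient :: "('a \<rightharpoonup> 'b) \<Rightarrow> ('a \<rightharpoonup> 'c) \<Rightarrow> ('b \<rightharpoonup> 'c)" where
  "left_quotient \<beta> \<alpha> b = (if b \<in> ran \<beta> then \<alpha> (SOME a. \<beta> a = Some b) else None)"

lemma left_quotient_at:
  assumes "\<beta> \<in> partial_injections A B" "\<beta> a = Some b"
  shows "left_quotient \<beta> \<alpha> b = \<alpha> a"
proof -
  have "(SOME a. \<beta> a = Some b) = a"
    using assms by (intro some_equality) (auto dest: partial_injections_injD)
  with assms(2) show ?thesis
    by (auto simp: left_quotient_def ran_def)
qed

lemma left_quotient_Some_iff:
  assumes "\<beta> \<in> partial_injections A B"
  shows "left_quotient \<beta> \<alpha> b = Some c \<longleftrightarrow> (\<exists>a. \<beta> a = Some b \<and> \<alpha> a = Some c)"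
proof (cases "b \<in> ran \<beta>")
  case True
  then obtain a where "\<beta> a = Some b"
    by (auto simp: ran_def)
  with assms show ?thesis
    by (metis left_quotient_at partial_injections_injD)
qed (auto simp: left_quotient_def ran_def)

lemma left_quotient_in_sym_inv:
  assumes "\<alpha> \<in> sym_inv n" "\<beta> \<in> sym_inv n"
  shows "left_quotient \<beta> \<alpha> \<in> sym_inv n"
proof -
  have \<alpha>: "\<alpha> \<in> partial_injections {1..n} {1..n}" and \<beta>: "\<beta> \<in> partial_injections {1..n} {1..n}"
    using assms by (simp_all add: sym_inv_eq_partial_injections)
  show ?thesis
    unfolding sym_inv_eq_partial_injections partial_injections_iff left_quotient_Some_iff[OF \<beta>]
  proof (intro conjI allI impI)
    fix b c assume "\<exists>a. \<beta> a = Some b \<and> \<alpha> a = Some c"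
    then show "b \<in> {1..n}" "c \<in> {1..n}"
      using \<alpha> \<beta> unfolding partial_injections_iff by blast+
  next
    fix b b' c
    assume "\<exists>a. \<beta> a = Some b \<and> \<alpha> a = Some c" "\<exists>a. \<beta> a = Some b' \<and> \<alpha> a = Some c"
    then show "b = b'"
      using partial_injections_injD[OF \<alpha>] by (metis option.inject)
  qed
qed

lemma card_dom_left_quotient:
  assumes "\<beta> \<in> sym_inv n" "dom \<beta> = dom \<alpha>"
  shows "card (dom (left_quotient \<beta> \<alpha>)) = card (dom \<alpha>)"
proof -
  have \<beta>: "\<beta> \<in> partial_injections {1..n} {1..n}"
    using assms by (simp add: sym_inv_eq_partial_injections)
  have "\<exists>c. \<alpha> a = Some c" if "\<beta> a = Some b" for a b
    using assms(2) that by (metis domD domI)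
  then have "(\<exists>c. left_quotient \<beta> \<alpha> b = Some c) \<longleftrightarrow> (\<exists>a. \<beta> a = Some b)" for b
    unfolding left_quotient_Some_iff[OF \<beta>] by blast
  then have "dom (left_quotient \<beta> \<alpha>) = ran \<beta>"
    unfolding dom_def ran_def by simp
  with card_ran_partial_injection[OF \<beta>] assms(2) show ?thesis
    by simp
qed

text \<open>
  This turns the requirement on a last factor \<open>x\<close> into one that depends on the preceding product
  \<open>p\<close> only through its restriction \<open>\<beta>\<close>, and that \<open>card_extensions_sym_inv\<close> counts.
\<close>

lemma left_quotient_le_iff:
  assumes "\<beta> \<in> sym_inv n" "dom \<beta> = dom \<alpha>" "\<beta> \<subseteq>\<^sub>m p"
  shows "left_quotient \<beta> \<alpha> \<subseteq>\<^sub>m x \<longleftrightarrow> \<alpha> \<subseteq>\<^sub>m pmap_mult p x"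
proof -
  have \<beta>: "\<beta> \<in> partial_injections {1..n} {1..n}"
    using assms by (simp add: sym_inv_eq_partial_injections)
  have common: "\<exists>b. \<beta> a = Some b \<and> p a = Some b" if "\<alpha> a = Some c" for a c
  proof -
    have "a \<in> dom \<beta>"
      using assms(2) that by (simp add: domI)
    then show ?thesis
      using assms(3) by (auto simp: map_le_iff_Some)
  qed
  have le: "p a = Some b" if "\<beta> a = Some b" for a b
    using assms(3) that by (simp add: map_le_iff_Some)
  show ?thesis
    unfolding map_le_iff_Some[of "left_quotient \<beta> \<alpha>"] map_le_iff_Some[of \<alpha>]
      left_quotient_Some_iff[OF \<beta>] pmap_mult_Some_iff
  proof (intro iffI allI impI)
    fix a c
    assume "\<forall>b c. (\<exists>a. \<beta> a = Some b \<and> \<alpha> a = Some c) \<longrightarrow> x b = Some c" and "\<alpha> a = Some c"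
    then show "\<exists>b. p a = Some b \<and> x b = Some c"
      using common by blast
  next
    fix b c
    assume x: "\<forall>a c. \<alpha> a = Some c \<longrightarrow> (\<exists>b. p a = Some b \<and> x b = Some c)"
      and "\<exists>a. \<beta> a = Some b \<and> \<alpha> a = Some c"
    then obtain a b' where "\<beta> a = Some b" "p a = Some b'" "x b' = Some c"
      by blast
    with le[of a b] show "x b = Some c"
      by simp
  qed
qed

text \<open>
  Being injective, \<open>p\<close> sends the points outside the domain of \<open>\<beta>\<close> to points outside \<open>ran \<beta>\<close>. There
  the quotient is undefined, so that whatever \<open>p\<close> does beyond \<open>\<beta>\<close> is cut off.
\<close>

lemma pmap_mult_left_quotient:
  assumes "p \<in> sym_inv n" "\<beta> \<in> sym_inv n" "dom \<beta> = dom \<alpha>" "\<beta> \<subseteq>\<^sub>m p"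
  shows "pmap_mult p (left_quotient \<beta> \<alpha>) = \<alpha>"
proof -
  have \<beta>: "\<beta> \<in> partial_injections {1..n} {1..n}" and p: "p \<in> partial_injections {1..n} {1..n}"
    using assms by (simp_all add: sym_inv_eq_partial_injections)
  have le: "p a = Some b" if "\<beta> a = Some b" for a b
    using assms(4) that by (simp add: map_le_iff_Some)
  have "\<exists>b. \<beta> a = Some b" if "\<alpha> a = Some c" for a c
  proof -
    have "a \<in> dom \<beta>"
      using assms(3) that by (simp add: domI)
    then show ?thesis
      by blast
  qed
  then have "pmap_mult p (left_quotient \<beta> \<alpha>) a = Some c \<longleftrightarrow> \<alpha> a = Some c" for a c
    unfolding pmap_mult_Some_iff left_quotient_Some_iff[OF \<beta>]
    using le by (blast dest: partial_injections_injD[OF p])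
  then show ?thesis
    by (intro ext) (metis option.exhaust)
qed

section \<open>Counting tuples by their product\<close>

definition extending_tuples :: "nat \<Rightarrow> nat \<Rightarrow> (nat \<rightharpoonup> nat) \<Rightarrow> (nat \<rightharpoonup> nat) list set" where
  "extending_tuples n k \<alpha> = {xs. set xs \<subseteq> sym_inv n \<and> length xs = k \<and> \<alpha> \<subseteq>\<^sub>m pmap_prod n xs}"

definition exact_tuples :: "nat \<Rightarrow> nat \<Rightarrow> (nat \<rightharpoonup> nat) \<Rightarrow> (nat \<rightharpoonup> nat) list set" where
  "exact_tuples n k \<alpha> = {xs. set xs \<subseteq> sym_inv n \<and> length xs = k \<and> pmap_prod n xs = \<alpha>}"

lemma finite_tuples: "finite {xs. set xs \<subseteq> sym_inv n \<and> length xs = k}"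
  by (intro finite_lists_length_eq finite_sym_inv)

lemma finite_extending_tuples: "finite (extending_tuples n k \<alpha>)"
  by (rule finite_subset[OF _ finite_tuples[of n k]]) (auto simp: extending_tuples_def)

lemma finite_exact_tuples: "finite (exact_tuples n k \<alpha>)"
  by (rule finite_subset[OF _ finite_tuples[of n k]]) (auto simp: exact_tuples_def)

lemma extending_tuples_determine_restriction:
  assumes "xs \<in> extending_tuples n k \<beta>" "xs \<in> extending_tuples n k \<beta>'" "dom \<beta> = dom \<beta>'"
  shows "\<beta> = \<beta>'"
proof -
  have "\<gamma> = pmap_prod n xs |` dom \<gamma>" if "xs \<in> extending_tuples n k \<gamma>" for \<gamma>
    using that by (auto simp: extending_tuples_def fun_eq_iff map_le_def restrict_map_def)
  with assms show ?thesis
    by metis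
qed

text \<open>
  Classify the tuples by the restriction \<open>\<beta>\<close> of the product of the first \<open>k\<close> factors to the domain
  of \<open>\<alpha>\<close>: the number of admissible last factors does not depend on \<open>\<beta>\<close>.
\<close>

lemma card_extending_tuples_Suc:
  assumes \<alpha>: "\<alpha> \<in> sym_inv n"
  shows "card (extending_tuples n (Suc k) \<alpha>)
           = (\<Sum>\<beta> | \<beta> \<in> sym_inv n \<and> dom \<beta> = dom \<alpha>.
                card (extending_tuples n k \<beta>) * card (sym_inv (n - card (dom \<alpha>))))"
proof -
  let ?I = "{\<beta> \<in> sym_inv n. dom \<beta> = dom \<alpha>}"
  let ?last = "\<lambda>\<beta>. {x \<in> sym_inv n. left_quotient \<beta> \<alpha> \<subseteq>\<^sub>m x}"
  let ?P = "SIGMA \<beta>:?I. extending_tuples n k \<beta> \<times> ?last \<beta>"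
  let ?snoc = "\<lambda>(\<beta>, xs, x). xs @ [x]"
  have "inj_on ?snoc ?P"
    by (rule inj_onI, clarsimp) (erule (1) extending_tuples_determine_restriction, simp)
  then have "card (?snoc ` ?P) = card ?P"
    by (rule card_image)
  moreover have "?snoc ` ?P = extending_tuples n (Suc k) \<alpha>"
  proof (intro equalityI subsetI)
    fix ys assume "ys \<in> ?snoc ` ?P"
    then obtain \<beta> xs x where "ys = xs @ [x]" "\<beta> \<in> ?I" "xs \<in> extending_tuples n k \<beta>" "x \<in> ?last \<beta>"
      by auto
    then show "ys \<in> extending_tuples n (Suc k) \<alpha>"
      by (auto simp: extending_tuples_def pmap_prod_snoc left_quotient_le_iff)
  next
    fix ys assume "ys \<in> extending_tuples n (Suc k) \<alpha>"
    then obtain xs x where ys: "ys = xs @ [x]" "set xs \<subseteq> sym_inv n" "x \<in> sym_inv n"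
        "length xs = k" and le: "\<alpha> \<subseteq>\<^sub>m pmap_mult (pmap_prod n xs) x"
      by (cases ys rule: rev_cases) (auto simp: extending_tuples_def pmap_prod_snoc)
    define \<beta> where "\<beta> = pmap_prod n xs |` dom \<alpha>"
    have "dom \<alpha> \<subseteq> dom (pmap_mult (pmap_prod n xs) x)"
      using le by (rule map_le_implies_dom_le)
    also have "\<dots> \<subseteq> dom (pmap_prod n xs)"
      by (auto simp: dom_def pmap_mult_Some_iff)
    finally have dom: "dom \<beta> = dom \<alpha>"
      by (auto simp: \<beta>_def)
    have sub: "\<beta> \<subseteq>\<^sub>m pmap_prod n xs"
      by (auto simp: \<beta>_def map_le_def)
    have mem: "\<beta> \<in> sym_inv n"
      using pmap_prod_in_sym_inv[OF ys(2)]
      by (auto simp: \<beta>_def sym_inv_eq_partial_injections partial_injections_iff restrict_map_def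
          split: if_splits)
    have "left_quotient \<beta> \<alpha> \<subseteq>\<^sub>m x"
      using le left_quotient_le_iff[OF mem dom sub] by simp
    with dom sub mem ys have "(\<beta>, xs, x) \<in> ?P"
      by (auto simp: extending_tuples_def)
    with ys(1) show "ys \<in> ?snoc ` ?P"
      by force
  qed
  ultimately have "card (extending_tuples n (Suc k) \<alpha>) = card ?P"
    by simp
  also have "\<dots> = (\<Sum>\<beta>\<in>?I. card (extending_tuples n k \<beta> \<times> ?last \<beta>))"
    by (intro card_SigmaI) (auto simp: finite_sym_inv finite_extending_tuples)
  also have "\<dots> = (\<Sum>\<beta>\<in>?I. card (extending_tuples n k \<beta>) * card (sym_inv (n - card (dom \<alpha>))))"
    using \<alpha> by (intro sum.cong) (auto simp: card_cartesian_product card_extensions_sym_inv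
        left_quotient_in_sym_inv card_dom_left_quotient[where n = n])
  finally show ?thesis
    by simp
qed

lemma card_extending_tuples:
  assumes "\<alpha> \<in> sym_inv n"
  shows "real (card (extending_tuples n (Suc k) \<alpha>))
           = falling_fact (real n) (card (dom \<alpha>)) ^ k
             * real (card (sym_inv (n - card (dom \<alpha>)))) ^ Suc k"
  using assms
proof (induction k arbitrary: \<alpha>)
  case 0
  have "extending_tuples n (Suc 0) \<alpha> = (\<lambda>x. [x]) ` {x \<in> sym_inv n. \<alpha> \<subseteq>\<^sub>m x}"
    by (auto simp: extending_tuples_def pmap_prod_singleton length_Suc_conv)
  then have "card (extending_tuples n (Suc 0) \<alpha>) = card {x \<in> sym_inv n. \<alpha> \<subseteq>\<^sub>m x}"
    by (simp add: card_image inj_on_def)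
  with 0 show ?case
    by (simp add: card_extensions_sym_inv)
next
  case (Suc k)
  have "dom \<alpha> \<subseteq> {1..n}"
    using Suc.prems by (simp add: sym_inv_def)
  let ?c = "real (card (sym_inv (n - card (dom \<alpha>))))" and ?f = "falling_fact (real n) (card (dom \<alpha>))"
  have "real (card (extending_tuples n (Suc (Suc k)) \<alpha>))
      = (\<Sum>\<beta> | \<beta> \<in> sym_inv n \<and> dom \<beta> = dom \<alpha>. real (card (extending_tuples n (Suc k) \<beta>)) * ?c)"
    by (simp only: card_extending_tuples_Suc[OF Suc.prems] of_nat_sum of_nat_mult)
  also have "\<dots> = (\<Sum>\<beta> | \<beta> \<in> sym_inv n \<and> dom \<beta> = dom \<alpha>. ?f ^ k * ?c ^ Suc k * ?c)"
    using Suc.IH by (intro sum.cong) auto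
  also have "\<dots> = ?f ^ Suc k * ?c ^ Suc (Suc k)"
    using card_sym_inv_dom_eq[OF \<open>dom \<alpha> \<subseteq> {1..n}\<close>] by simp
  finally show ?case .
qed

text \<open>
  A tuple whose product extends \<open>\<beta>\<close>, continued by \<open>\<beta>\<^sup>-\<^sup>1\<alpha>\<close>, has product exactly \<open>\<alpha>\<close>; the tuple
  determines \<open>\<beta>\<close>, so that different pairs yield different continuations.
\<close>

lemma card_exact_tuples_Suc_ge:
  assumes \<alpha>: "\<alpha> \<in> sym_inv n"
  shows "(\<Sum>\<beta> | \<beta> \<in> sym_inv n \<and> dom \<beta> = dom \<alpha>. card (extending_tuples n k \<beta>))
           \<le> card (exact_tuples n (Suc k) \<alpha>)"
proof -
  let ?I = "{\<beta> \<in> sym_inv n. dom \<beta> = dom \<alpha>}"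
  let ?P = "SIGMA \<beta>:?I. extending_tuples n k \<beta>"
  let ?snoc = "\<lambda>(\<beta>, xs). xs @ [left_quotient \<beta> \<alpha>]"
  have "inj_on ?snoc ?P"
    by (rule inj_onI, clarsimp) (erule (1) extending_tuples_determine_restriction, simp)
  moreover have "?snoc ` ?P \<subseteq> exact_tuples n (Suc k) \<alpha>"
    using \<alpha> by (auto simp: extending_tuples_def exact_tuples_def pmap_prod_snoc
        pmap_mult_left_quotient[where n = n] pmap_prod_in_sym_inv left_quotient_in_sym_inv)
  ultimately have "card ?P \<le> card (exact_tuples n (Suc k) \<alpha>)"
    by (rule card_inj_on_le[OF _ _ finite_exact_tuples])
  moreover have "card ?P = (\<Sum>\<beta>\<in>?I. card (extending_tuples n k \<beta>))"
    by (intro card_SigmaI) (auto simp: finite_sym_inv finite_extending_tuples)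
  ultimately show ?thesis
    by simp
qed

lemma card_exact_tuples_ge:
  assumes \<alpha>: "\<alpha> \<in> sym_inv n"
  shows "falling_fact (real n) (card (dom \<alpha>)) ^ k * real (card (sym_inv (n - card (dom \<alpha>)))) ^ k
           \<le> real (card (exact_tuples n (Suc k) \<alpha>))"
proof (cases k)
  case 0
  \<comment> \<open>The formula for extending tuples presupposes a factor, as the empty product extends only subidentities.\<close>
  have "[\<alpha>] \<in> exact_tuples n (Suc 0) \<alpha>"
    using \<alpha> by (simp add: exact_tuples_def pmap_prod_singleton)
  then have "card (exact_tuples n (Suc 0) \<alpha>) > 0"
    using finite_exact_tuples by (auto simp: card_gt_0_iff)
  with 0 show ?thesis
    by simp
next
  case (Suc m)
  have "dom \<alpha> \<subseteq> {1..n}"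
    using \<alpha> by (simp add: sym_inv_def)
  let ?c = "real (card (sym_inv (n - card (dom \<alpha>))))" and ?f = "falling_fact (real n) (card (dom \<alpha>))"
  have "?f ^ k * ?c ^ k = (\<Sum>\<beta> | \<beta> \<in> sym_inv n \<and> dom \<beta> = dom \<alpha>. ?f ^ m * ?c ^ Suc m)"
    using card_sym_inv_dom_eq[OF \<open>dom \<alpha> \<subseteq> {1..n}\<close>] by (simp add: Suc)
  also have "\<dots> = (\<Sum>\<beta> | \<beta> \<in> sym_inv n \<and> dom \<beta> = dom \<alpha>. real (card (extending_tuples n k \<beta>)))"
    by (intro sum.cong) (auto simp: Suc card_extending_tuples)
  also have "\<dots> \<le> real (card (exact_tuples n (Suc k) \<alpha>))"
    using card_exact_tuples_Suc_ge[OF \<alpha>, of k] by (simp flip: of_nat_sum)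
  finally show ?thesis .
qed

section \<open>From counts to probabilities\<close>

lemma pmf_replicate_pmf:
  "pmf (replicate_pmf k p) xs = (if length xs = k then (\<Prod>x\<leftarrow>xs. pmf p x) else 0)"
proof (induction k arbitrary: xs)
  case 0
  then show ?case
    by (auto simp: indicator_def)
next
  case (Suc k)
  have "replicate_pmf (Suc k) p = map_pmf (\<lambda>(x, xs). x # xs) (pair_pmf p (replicate_pmf k p))"
    by (simp add: pair_pmf_def map_bind_pmf bind_return_pmf bind_assoc_pmf map_pmf_def)
  show ?case
  proof (cases xs)
    case Nil
    then show ?thesis
      using set_replicate_pmf[of "Suc k" p] by (simp add: pmf_eq_0_set_pmf del: replicate_pmf.simps)
  next
    case (Cons y ys)
    have "pmf (replicate_pmf (Suc k) p) (y # ys)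
        = pmf (map_pmf (\<lambda>(x, xs). x # xs) (pair_pmf p (replicate_pmf k p))) ((\<lambda>(x, xs). x # xs) (y, ys))"
      using \<open>replicate_pmf (Suc k) p = _\<close> by simp
    also have "\<dots> = pmf (pair_pmf p (replicate_pmf k p)) (y, ys)"
      by (rule pmf_map_inj') (auto simp: inj_def)
    finally show ?thesis
      using Cons Suc by (simp add: pmf_pair del: replicate_pmf.simps)
  qed
qed

lemma replicate_pmf_of_set:
  assumes "finite S" "S \<noteq> {}"
  shows "replicate_pmf k (pmf_of_set S) = pmf_of_set {xs. set xs \<subseteq> S \<and> length xs = k}"
proof (rule pmf_eqI)
  fix xs
  have "replicate k (SOME x. x \<in> S) \<in> {xs. set xs \<subseteq> S \<and> length xs = k}"
    using assms(2) by (auto simp: some_in_eq)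
  then have "{xs. set xs \<subseteq> S \<and> length xs = k} \<noteq> {}"
    by blast
  moreover have "(\<Prod>x\<leftarrow>xs. pmf (pmf_of_set S) x)
      = (if set xs \<subseteq> S then 1 / real (card S) ^ length xs else 0)"
    using assms by (induction xs) (auto simp: indicator_def)
  ultimately show "pmf (replicate_pmf k (pmf_of_set S)) xs
      = pmf (pmf_of_set {xs. set xs \<subseteq> S \<and> length xs = k}) xs"
    using assms
    by (simp add: pmf_replicate_pmf finite_lists_length_eq card_lists_length_eq indicator_def)
qed

lemma prod_prob_eq_card:
  "prod_prob k n \<alpha> = real (card (exact_tuples n k \<alpha>)) / real (card (sym_inv n)) ^ k"
proof -
  let ?T = "{xs. set xs \<subseteq> sym_inv n \<and> length xs = k}"
  have "replicate k Map.empty \<in> ?T"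
    by (auto simp: sym_inv_def)
  then have "?T \<noteq> {}"
    by blast
  moreover have "?T \<inter> {xs. pmap_prod n xs = \<alpha>} = exact_tuples n k \<alpha>"
    by (auto simp: exact_tuples_def)
  ultimately show ?thesis
    by (simp add: prod_prob_def replicate_pmf_of_set finite_sym_inv sym_inv_nonempty
        measure_pmf_of_set finite_tuples card_lists_length_eq)
qed

theorem corollary6:
  fixes n k i :: nat and \<alpha> :: "nat \<rightharpoonup> nat"
  assumes "n \<ge> 1" and "k \<ge> 1" and "i \<le> n"
    and "\<alpha> \<in> sym_inv n" and "pmap_rank \<alpha> = i"
  shows "real (card (sym_inv (n - i))) ^ k / real (card (sym_inv n)) ^ k
           * falling_fact (real n) i ^ (k - 1) \<ge> prod_prob k n \<alpha>
       \<and> prod_prob k n \<alpha> \<ge>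
         real (card (sym_inv (n - i))) ^ (k - 1) / real (card (sym_inv n)) ^ k
           * falling_fact (real n) i ^ (k - 1)"
proof -
  obtain m where k: "k = Suc m"
    using \<open>k \<ge> 1\<close> by (cases k) auto
  have i: "card (dom \<alpha>) = i"
    using \<open>pmap_rank \<alpha> = i\<close> by (simp add: pmap_rank_def)
  let ?N = "real (card (exact_tuples n k \<alpha>))"
  have "exact_tuples n k \<alpha> \<subseteq> extending_tuples n k \<alpha>"
    by (auto simp: exact_tuples_def extending_tuples_def)
  then have "?N \<le> real (card (extending_tuples n k \<alpha>))"
    by (simp add: card_mono finite_extending_tuples)
  also have "\<dots> = real (card (sym_inv (n - i))) ^ k * falling_fact (real n) i ^ (k - 1)"
    using card_extending_tuples[OF \<open>\<alpha> \<in> sym_inv n\<close>, of m] by (simp add: k i)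
  finally have upper: "?N \<le> \<dots>" .
  have lower: "real (card (sym_inv (n - i))) ^ (k - 1) * falling_fact (real n) i ^ (k - 1) \<le> ?N"
    using card_exact_tuples_ge[OF \<open>\<alpha> \<in> sym_inv n\<close>, of m] by (simp add: k i mult.commute)
  show ?thesis
    using divide_right_mono[OF upper, of "real (card (sym_inv n)) ^ k"]
      divide_right_mono[OF lower, of "real (card (sym_inv n)) ^ k"]
    by (simp add: prod_prob_eq_card)
qed

end
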